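(* Let $I=(\mathcal{M},\mathcal{J})$ be an instance of the makespan scheduling problem and let $(\mathrm{Args}_F,\rightsquigarrow_F)$ be its feasibility AF. For any schedule $S$ and any extension $E\subseteq \mathrm{Args}_F$ that correspond to each other ($S\approx E$), $S$ is feasible if and only if $E$ is stable in $(\mathrm{Args}_F,\rightsquigarrow_F)$.
   Context: Makespan scheduling. An instance is a pair $(\mathcal{M},\mathcal{J})$ with machines $\mathcal{M}=\{1,\dots,m\}$ and jobs $\mathcal{J}=\{1,\dots,n\}$, $m,n\geq 1$, where each job $j$ has a processing time $p_j\ge 0$. A schedule is a matrix $S=(x_{i,j})\in\{0,1\}^{m\times n}$ ($x_{i,j}=1$ means job $j$ is assigned to machine $i$); no further constraint is imposed on a schedule. $S$ is feasible iff it meets the constraints (with auxiliary real variables $C_i$, $C_{\max}$): $C_{\max}\geq C_i$ for all $i\in\mathcal{M}$; $C_i=\sum_{j=1}^n x_{i,j}p_j$ for all $i\in\mathcal{M}$; and $\sum_{i=1}^m x_{i,j}=1$ for all $j\in\mathcal{J}$. Abstract argumentation. An abstract argumentation framework (AF) is a directed graph $(\mathrm{Args},\rightsquigarrow)$ with a set $\mathrm{Args}$ of arguments and a binary attack relation $\rightsquigarrow$ on $\mathrm{Args}$. An extension is a set $E\subseteq\mathrm{Args}$. It is conflict-free iff there are no $a,b\in E$ with $a\rightsquigarrow b$; it is stable iff it is conflict-free and for every $b\in\mathrm{Args}\setminus E$ there is $a\in E$ with $a\rightsquigarrow b$. Feasibility AF: $\mathrm{Args}_F=\{a_{i,j}: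 i\in\mathcal{M}, j\in\mathcal{J}\}$ (pairwise distinct arguments) and $a_{i,j}\rightsquigarrow_F a_{k,l}$ iff $i\neq k$ and $j=l$. Correspondence: a schedule $S=(x_{i,j})$ and $E\subseteq\mathrm{Args}_F$ are corresponding, written $S\approx E$, when for all $i,j$: $x_{i,j}=1$ iff $a_{i,j}\in E$. *)

theory Defs
  imports Complex_Main "Graph_Theory.Pair_Digraph"
begin

section \<open>Makespan scheduling\<close>

record makespan =
  num_machines :: nat
  num_jobs :: nat
  ptime :: "nat \<Rightarrow> real"

definition machines :: "makespan \<Rightarrow> nat set" where
  "machines I = {1..num_machines I}"

definition jobs :: "makespan \<Rightarrow> nat set" where
  "jobs I = {1..num_jobs I}"

definition makespan_instance :: "makespan \<Rightarrow> bool" where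
  "makespan_instance I \<longleftrightarrow>
     num_machines I \<ge> 1 \<and> num_jobs I \<ge> 1 \<and> (\<forall>j\<in>jobs I. ptime I j \<ge> 0)"

text \<open>
  A matrix is a function of two indices; only its values at \<open>i \<in> machines I\<close>,
  \<open>j \<in> jobs I\<close> are ever inspected, so the values elsewhere are irrelevant.
\<close>

definition schedule :: "makespan \<Rightarrow> (nat \<Rightarrow> nat \<Rightarrow> nat) \<Rightarrow> bool" where
  "schedule I x \<longleftrightarrow> (\<forall>i\<in>machines I. \<forall>j\<in>jobs I. x i j \<in> {0, 1})"

definition feasible :: "makespan \<Rightarrow> (nat \<Rightarrow> nat \<Rightarrow> nat) \<Rightarrow> bool" where
  "feasible I x \<longleftrightarrow>
     (\<exists>(C :: nat \<Rightarrow> real) (C\<^sub>m\<^sub>a\<^sub>x :: real).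
        (\<forall>i\<in>machines I. C\<^sub>m\<^sub>a\<^sub>x \<ge> C i) \<and>
        (\<forall>i\<in>machines I. C i = (\<Sum>j\<in>jobs I. real (x i j) * ptime I j)) \<and>
        (\<forall>j\<in>jobs I. (\<Sum>i\<in>machines I. x i j) = 1))"


section \<open>Abstract argumentation\<close>

text \<open>
  An argumentation framework is a directed graph without parallel arcs (loops, i.e.
  self-attacks, are allowed): \<open>pverts\<close> are the arguments, and \<open>(a, b) \<in> parcs F\<close>
  says that \<open>a\<close> attacks \<open>b\<close>.
\<close>

definition conflict_free :: "'a pair_pre_digraph \<Rightarrow> 'a set \<Rightarrow> bool" where
  "conflict_free F E \<longleftrightarrow> \<not> (\<exists>a\<in>E. \<exists>b\<in>E. (a, b) \<in> parcs F)"

definition stable_extension :: "'a pair_pre_digraph \<Rightarrow> 'a set \<Rightarrow> bool" where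
  "stable_extension F E \<longleftrightarrow>
     conflict_free F E \<and> (\<forall>b\<in>pverts F - E. \<exists>a\<in>E. (a, b) \<in> parcs F)"


section \<open>The feasibility framework\<close>

datatype argument = Assign nat nat

definition feasibility_af :: "makespan \<Rightarrow> argument pair_pre_digraph" where
  "feasibility_af I =
     \<lparr> pverts = {Assign i j | i j. i \<in> machines I \<and> j \<in> jobs I},
       parcs = {(Assign i j, Assign k l) | i j k l.
                  i \<in> machines I \<and> j \<in> jobs I \<and> k \<in> machines I \<and> l \<in> jobs I \<and>
                  i \<noteq> k \<and> j = l} \<rparr>"

lemma pair_wf_digraph_feasibility_af: "pair_wf_digraph (feasibility_af I)"
  by unfold_locales (auto simp: feasibility_af_def)

definition corresponding :: "makespan \<Rightarrow> (nat \<Rightarrow> nat \<Rightarrow> nat) \<Rightarrow> argument set \<Rightarrow> bool" where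
  "corresponding I x E \<longleftrightarrow>
     (\<forall>i\<in>machines I. \<forall>j\<in>jobs I. x i j = 1 \<longleftrightarrow> Assign i j \<in> E)"

end

theory Submission
  imports Defs
begin

text \<open>
  Both sides say that every job has exactly one machine: on the argumentation side, conflict-freeness
  gives at most one machine per job, and an unassigned job \<open>j\<close> would leave \<open>Assign i j\<close> unattacked,
  since attacks only relate arguments of the same job.
\<close>

lemma finite_machines [simp]: "finite (machines I)"
  by (simp add: machines_def)

text \<open>The completion times and the makespan never restrict a matrix: the equations determine
  each \<open>C i\<close>, and finitely many reals have an upper bound.\<close>

lemma feasible_iff_sum_eq_1:
  "feasible I x \<longleftrightarrow> (\<forall>j\<in>jobs I. (\<Sum>i\<in>machines I. x i j) = 1)"
proof
  assume sum1: "\<forall>j\<in>jobs I. (\<Sum>i\<in>machines I. x i j) = 1"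
  define C where "C i = (\<Sum>j\<in>jobs I. real (x i j) * ptime I j)" for i
  \<comment> \<open>If there are no machines, \<open>Max\<close> is applied to the empty set, but
    the bound is then vacuous.\<close>
  have "\<forall>i\<in>machines I. C i \<le> Max (C ` machines I)"
    by simp
  with sum1 show "feasible I x"
    unfolding feasible_def
    by (intro exI[of _ C] exI[of _ "Max (C ` machines I)"]) (simp add: C_def)
qed (auto simp: feasible_def)

text \<open>A sum of zeros and ones counts the ones. This turns the arithmetic constraint into the
  unique existence that also characterises stability.\<close>

lemma sum_binary_eq_1_iff_ex1:
  fixes f :: "'a \<Rightarrow> nat"
  assumes "finite A" and "\<forall>a\<in>A. f a \<in> {0, 1}"
  shows "sum f A = 1 \<longleftrightarrow> (\<exists>!a. a \<in> A \<and> f a = 1)"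
proof -
  have zero_iff: "f a = 0 \<longleftrightarrow> f a \<noteq> 1" if "a \<in> A" for a
    using assms(2) that by force
  have "sum f A = 1 \<longleftrightarrow> (\<exists>a\<in>A. f a = 1 \<and> (\<forall>b\<in>A. a \<noteq> b \<longrightarrow> f b = 0))"
    using assms(1) by (rule sum_eq_1_iff)
  also have "\<dots> \<longleftrightarrow> (\<exists>a\<in>A. f a = 1 \<and> (\<forall>b\<in>A. a \<noteq> b \<longrightarrow> f b \<noteq> 1))"
    by (simp only: zero_iff cong: ball_cong)
  also have "\<dots> \<longleftrightarrow> (\<exists>!a. a \<in> A \<and> f a = 1)"
    by metis
  finally show ?thesis .
qed

lemma attacks_feasibility_af_iff [simp]:
  "(Assign i j, Assign k l) \<in> parcs (feasibility_af I) \<longleftrightarrow>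
     i \<in> machines I \<and> j \<in> jobs I \<and> k \<in> machines I \<and> i \<noteq> k \<and> j = l"
  by (auto simp: feasibility_af_def)

text \<open>Nonemptiness of \<open>machines I\<close> matters: without machines there are no
  arguments, so the empty extension is stable although no job has a machine.\<close>

lemma stable_extension_feasibility_af_iff:
  assumes "machines I \<noteq> {}" and sub: "E \<subseteq> pverts (feasibility_af I)"
  shows "stable_extension (feasibility_af I) E \<longleftrightarrow>
           (\<forall>j\<in>jobs I. \<exists>!i. i \<in> machines I \<and> Assign i j \<in> E)"
    (is "?stable \<longleftrightarrow> ?unique")
proof -
  have E_cases: "\<exists>i j. a = Assign i j \<and> i \<in> machines I \<and> j \<in> jobs I" if "a \<in> E" for a
    using sub that by (auto simp: feasibility_af_def)
  show ?thesis
  proof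
    assume stable: ?stable
    show ?unique
    proof
      fix j
      assume j: "j \<in> jobs I"
      \<comment> \<open>Any machine \<open>i\<close> serves as a probe: \<open>Assign i j\<close> is
        in \<open>E\<close>, or its attacker from \<open>E\<close> concerns the same job
        \<open>j\<close> and supplies the machine.\<close>
      obtain i where i: "i \<in> machines I"
        using assms(1) by blast
      have "\<exists>k. k \<in> machines I \<and> Assign k j \<in> E"
      proof (cases "Assign i j \<in> E")
        case False
        with i j have "Assign i j \<in> pverts (feasibility_af I) - E"
          by (simp add: feasibility_af_def)
        with stable obtain a where "a \<in> E" "(a, Assign i j) \<in> parcs (feasibility_af I)"
          unfolding stable_extension_def by blast
        then show ?thesis
          using E_cases by fastforce
      qed (use i in blast)
      \<comment> \<open>Distinct machines for one job would give two arguments of \<open>E\<close>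
        that attack each other.\<close>
      moreover have "k = l"
        if "k \<in> machines I" "l \<in> machines I" "Assign k j \<in> E" "Assign l j \<in> E" for k l
        using stable that j by (force simp: stable_extension_def conflict_free_def)
      ultimately show "\<exists>!i. i \<in> machines I \<and> Assign i j \<in> E"
        by blast
    qed
  next
    assume unique: ?unique
    show ?stable
      unfolding stable_extension_def conflict_free_def
    proof (intro conjI notI ballI)
      assume "\<exists>a\<in>E. \<exists>b\<in>E. (a, b) \<in> parcs (feasibility_af I)"
      then obtain a b where ab: "a \<in> E" "b \<in> E" "(a, b) \<in> parcs (feasibility_af I)"
        by blast
      then obtain i j k l where "a = Assign i j" "b = Assign k l"
        using E_cases by meson
      with ab unique show False
        by auto
    next
      fix b
      assume b: "b \<in> pverts (feasibility_af I) - E"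
      then obtain k j where kj: "b = Assign k j" "k \<in> machines I" "j \<in> jobs I"
        by (auto simp: feasibility_af_def)
      \<comment> \<open>The machine chosen for job \<open>j\<close> differs from \<open>k\<close>,
        because \<open>b\<close> lies outside \<open>E\<close>; hence its argument attacks
        \<open>b\<close>.\<close>
      with unique obtain i where "i \<in> machines I" "Assign i j \<in> E"
        by blast
      with b kj show "\<exists>a\<in>E. (a, b) \<in> parcs (feasibility_af I)"
        by (intro bexI[of _ "Assign i j"]) auto
    qed
  qed
qed

theorem theorem1:
  fixes I :: makespan and S :: "nat \<Rightarrow> nat \<Rightarrow> nat" and E :: "argument set"
  assumes "makespan_instance I"
    and "schedule I S"
    and "E \<subseteq> pverts (feasibility_af I)"
    and "corresponding I S E"
  shows "feasible I S \<longleftrightarrow> stable_extension (feasibility_af I) E"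
proof -
  have "machines I \<noteq> {}"
    using assms(1) by (simp add: makespan_instance_def machines_def)
  then have stable: "stable_extension (feasibility_af I) E \<longleftrightarrow>
      (\<forall>j\<in>jobs I. \<exists>!i. i \<in> machines I \<and> Assign i j \<in> E)"
    using assms(3) by (rule stable_extension_feasibility_af_iff)
  \<comment> \<open>The equivalence holds job by job, since the correspondence can be applied to
    each column of the matrix separately.\<close>
  have "(\<Sum>i\<in>machines I. S i j) = 1 \<longleftrightarrow> (\<exists>!i. i \<in> machines I \<and> Assign i j \<in> E)"
    if j: "j \<in> jobs I" for j
  proof -
    have "(\<Sum>i\<in>machines I. S i j) = 1 \<longleftrightarrow> (\<exists>!i. i \<in> machines I \<and> S i j = 1)"
      using assms(2) j by (intro sum_binary_eq_1_iff_ex1) (auto simp: schedule_def)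
    also have "\<dots> \<longleftrightarrow> (\<exists>!i. i \<in> machines I \<and> Assign i j \<in> E)"
      using assms(4) j unfolding corresponding_def by metis
    finally show ?thesis .
  qed
  then show ?thesis
    by (simp add: feasible_iff_sum_eq_1 stable)
qed

end
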